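(* Let $\mathcal{H}$ be a complex Hilbert space and let $S,T\in\mathbb{B}(\mathcal{H})$. If both $S$ and $T$ are accretive-dissipative, then $$\omega(ST)\le 2\,\omega(S)\,\omega(T).$$ If either $T$ or $S$ is accretive-dissipative (the other being an arbitrary bounded operator), then $$\omega(ST)\le 2\sqrt{2}\,\omega(S)\,\omega(T).$$
   Context: $\mathbb{B}(\mathcal{H})$ is the $C^*$-algebra of bounded linear operators on $\mathcal{H}$. The numerical radius is $\omega(T)=\sup_{\|x\|=1}|\langle Tx,x\rangle|$. An operator $A\in\mathbb{B}(\mathcal{H})$ is called positive if $\langle Ax,x\rangle>0$ for all nonzero $x\in\mathcal{H}$. The real and imaginary parts of $T$ are $\Re T=\frac{T+T^*}{2}$ and $\Im T=\frac{T-T^*}{2i}$. $T$ is called accretive-dissipative if both $\Re T$ and $\Im T$ are positive. *)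

theory Defs
  imports "HOL-Analysis.Analysis" "HOL-Library.Complex_Order"
begin

class complex_vector = real_vector +
  fixes scaleC :: "complex \<Rightarrow> 'a \<Rightarrow> 'a" (infixr "*\<^sub>C" 75)
  assumes scaleC_add_right: "c *\<^sub>C (x + y) = c *\<^sub>C x + c *\<^sub>C y"
    and scaleC_add_left: "(c + d) *\<^sub>C x = c *\<^sub>C x + d *\<^sub>C x"
    and scaleC_scaleC: "c *\<^sub>C (d *\<^sub>C x) = (c * d) *\<^sub>C x"
    and scaleR_scaleC: "r *\<^sub>R x = complex_of_real r *\<^sub>C x"

(* The inner product is linear in its first argument. *)
class complex_inner = complex_vector + real_normed_vector +
  fixes cinner :: "'a \<Rightarrow> 'a \<Rightarrow> complex"
  assumes cinner_commute: "cinner x y = cnj (cinner y x)"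
    and cinner_add_left: "cinner (x + y) z = cinner x z + cinner y z"
    and cinner_scaleC_left: "cinner (c *\<^sub>C x) y = c * cinner x y"
    and cinner_ge_zero: "0 \<le> cinner x x"
    and cinner_eq_zero_iff: "cinner x x = 0 \<longleftrightarrow> x = 0"
    and norm_eq_sqrt_cinner: "norm x = sqrt (Re (cinner x x))"

class complex_hilbert_space = complex_inner + complete_space

instantiation complex :: complex_hilbert_space
begin

definition scaleC_complex :: "complex \<Rightarrow> complex \<Rightarrow> complex"
  where "scaleC_complex c x = c * x"

definition cinner_complex :: "complex \<Rightarrow> complex \<Rightarrow> complex"
  where "cinner_complex x y = x * cnj y"

instance
proof
  fix x :: complex
  show "norm x = sqrt (Re (cinner x x))"
    by (simp add: cinner_complex_def cmod_def power2_eq_square)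
qed (auto simp: scaleC_complex_def cinner_complex_def algebra_simps scaleR_conv_of_real
  less_eq_complex_def)

end

definition bounded_clinear :: "('a::complex_inner \<Rightarrow> 'b::complex_inner) \<Rightarrow> bool"
  where "bounded_clinear T \<longleftrightarrow> bounded_linear T \<and> (\<forall>c x. T (c *\<^sub>C x) = c *\<^sub>C T x)"

(* For bounded operators on a Hilbert space the chosen map exists and is unique, by the Riesz
   representation theorem. *)
definition cadjoint :: "('a::complex_hilbert_space \<Rightarrow> 'a) \<Rightarrow> 'a \<Rightarrow> 'a"
  where "cadjoint T = (SOME T'. bounded_clinear T' \<and> (\<forall>x y. cinner (T x) y = cinner x (T' y)))"

definition real_part :: "('a::complex_hilbert_space \<Rightarrow> 'a) \<Rightarrow> 'a \<Rightarrow> 'a"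
  where "real_part T = (\<lambda>x. (1 / 2) *\<^sub>C (T x + cadjoint T x))"

definition imag_part :: "('a::complex_hilbert_space \<Rightarrow> 'a) \<Rightarrow> 'a \<Rightarrow> 'a"
  where "imag_part T = (\<lambda>x. (1 / (2 * \<i>)) *\<^sub>C (T x - cadjoint T x))"

(* In the order on the complex numbers, 0 < z means that z is real and Re z > 0. *)
definition positive_operator :: "('a::complex_hilbert_space \<Rightarrow> 'a) \<Rightarrow> bool"
  where "positive_operator A \<longleftrightarrow> bounded_clinear A \<and> (\<forall>x. x \<noteq> 0 \<longrightarrow> 0 < cinner (A x) x)"

definition accretive_dissipative :: "('a::complex_hilbert_space \<Rightarrow> 'a) \<Rightarrow> bool"
  where "accretive_dissipative T \<longleftrightarrow>
    bounded_clinear T \<and> positive_operator (real_part T) \<and> positive_operator (imag_part T)"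

(* The supremum is over nonnegative reals, so inserting 0 only matters when the space is trivial
   and has no unit vectors; there it makes the numerical radius 0 instead of the unspecified
   supremum of the empty set of reals. *)
definition numerical_radius :: "('a::complex_inner \<Rightarrow> 'a) \<Rightarrow> real"
  where "numerical_radius T = Sup (insert 0 {cmod (cinner (T x) x) | x. norm x = 1})"

end

theory Submission
  imports Defs
begin

text \<open>
  Everything follows from the operator norm bounds \<open>\<parallel>T\<parallel> \<le> 2 \<omega>(T)\<close>, a consequence of polarization, and
  \<open>\<parallel>T\<parallel> \<le> \<surd>2 \<omega>(T)\<close> for accretive-dissipative \<open>T\<close>. For the latter write \<open>T = A + iB\<close> with \<open>A, B \<ge> 0\<close>.
  The Cauchy-Schwarz inequalities for the forms of \<open>A\<close> and \<open>B\<close>, followed by the one in the plane, give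
  \<open>|\<langle>Tx,y\<rangle>|\<^sup>2 \<le> \<langle>(A+B)x,x\<rangle> \<langle>(A+B)y,y\<rangle>\<close>, and \<open>\<langle>(A+B)x,x\<rangle> \<le> \<surd>2 |\<langle>Tx,x\<rangle>|\<close> because \<open>\<langle>Ax,x\<rangle>\<close> and
  \<open>\<langle>Bx,x\<rangle>\<close> are the real and imaginary parts of \<open>\<langle>Tx,x\<rangle>\<close>.
\<close>

section \<open>Algebra of the inner product and of complex-linear maps\<close>

lemma scaleC_one: "1 *\<^sub>C x = (x::'a::complex_vector)"
  using scaleR_scaleC[of 1 x] by simp

lemma cinner_add_right: "cinner x (y + z) = cinner x y + cinner x (z::'a::complex_inner)"
  by (metis cinner_add_left cinner_commute complex_cnj_add)

lemma cinner_scaleC_right: "cinner x (c *\<^sub>C y) = cnj c * cinner x (y::'a::complex_inner)"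
  by (metis cinner_commute cinner_scaleC_left complex_cnj_mult)

lemma cinner_self: "cinner x x = complex_of_real ((norm (x::'a::complex_inner))\<^sup>2)"
  using cinner_ge_zero[of x]
  by (simp add: complex_eq_iff less_eq_complex_def norm_eq_sqrt_cinner)

lemma bounded_clinear_add: "bounded_clinear T \<Longrightarrow> T (x + y) = T x + T y"
  by (simp add: bounded_clinear_def bounded_linear.linear linear_add)

lemma bounded_clinear_scaleC: "bounded_clinear T \<Longrightarrow> T (c *\<^sub>C x) = c *\<^sub>C T x"
  by (simp add: bounded_clinear_def)

lemma bounded_clinear_zero: "bounded_clinear T \<Longrightarrow> T 0 = 0"
  by (simp add: bounded_clinear_def bounded_linear.linear linear_0)

lemma bounded_clinear_ident: "bounded_clinear (\<lambda>x. x)"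
  by (simp add: bounded_clinear_def bounded_linear_ident)

section \<open>Positive forms and the Cauchy-Schwarz inequality\<close>

lemma cinner_clinear_expand:
  assumes "bounded_clinear A"
  shows "cinner (A (x + c *\<^sub>C y)) (x + c *\<^sub>C y) =
    cinner (A x) x + cnj c * cinner (A x) y + c * cinner (A y) x + c * cnj c * cinner (A y) y"
  by (simp add: bounded_clinear_add[OF assms] bounded_clinear_scaleC[OF assms] cinner_add_left
      cinner_add_right cinner_scaleC_left cinner_scaleC_right algebra_simps)

text \<open>Polarization: since the form is real at \<open>x + y\<close>, the imaginary parts of the
  two cross terms are opposite; since it is real at \<open>x + \<i> *\<^sub>C y\<close>, their real
  parts agree.\<close>

lemma nonneg_form_hermitian:
  assumes A: "bounded_clinear A" and pos: "\<And>x. 0 \<le> cinner (A x) x"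
  shows "cinner (A y) x = cnj (cinner (A x) y)"
proof -
  have im: "Im (cinner (A z) z) = 0" for z
    using pos[of z] by (simp add: less_eq_complex_def)
  show ?thesis
    using im[of "x + 1 *\<^sub>C y"] im[of "x + \<i> *\<^sub>C y"]
    unfolding cinner_clinear_expand[OF A] by (simp add: im complex_eq_iff)
qed

text \<open>Discriminant argument: along a suitable line through \<open>x\<close> in direction
  \<open>y\<close> the form is a nonnegative real quadratic.\<close>

lemma nonneg_form_Cauchy_Schwarz:
  assumes A: "bounded_clinear A" and pos: "\<And>x. 0 \<le> cinner (A x) x"
  shows "(cmod (cinner (A x) y))\<^sup>2 \<le> Re (cinner (A x) x) * Re (cinner (A y) y)"
proof -
  define c where "c = cinner (A x) y"
  define a where "a = Re (cinner (A x) x)"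
  define b where "b = Re (cinner (A y) y)"
  have b: "b \<ge> 0"
    using pos[of y] by (simp add: b_def less_eq_complex_def)
  have herm: "cinner (A y) x = cnj c"
    unfolding c_def by (rule nonneg_form_hermitian[OF A pos])
  \<comment> \<open>The factor \<open>c\<close> in the coefficient of \<open>y\<close> aligns the
    phases: both cross terms equal \<open>- r * (cmod c)\<^sup>2\<close>.\<close>
  have quad: "0 \<le> a - 2 * r * (cmod c)\<^sup>2 + r\<^sup>2 * (cmod c)\<^sup>2 * b" for r
  proof -
    have im: "Im (cinner (A y) y) = 0"
      using pos[of y] by (simp add: less_eq_complex_def)
    have "0 \<le> Re (cinner (A (x + (- r * c) *\<^sub>C y)) (x + (- r * c) *\<^sub>C y))"
      using pos by (simp add: less_eq_complex_def)
    then show ?thesis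
      unfolding cinner_clinear_expand[OF A] herm c_def[symmetric] cmod_power2
      by (simp add: a_def b_def im power2_eq_square algebra_simps)
  qed
  have "(cmod c)\<^sup>2 \<le> a * b"
  proof (cases "b = 0")
    case True
    have "c = 0"
    proof (rule ccontr)
      assume "c \<noteq> 0"
      then show False
        \<comment> \<open>With \<open>b = 0\<close> the bound is affine in \<open>r\<close>, and
          this \<open>r\<close> gives it the value -1.\<close>
        using quad[of "(a + 1) / (2 * (cmod c)\<^sup>2)"] True by (simp add: field_simps)
    qed
    then show ?thesis
      by (simp add: True)
  next
    case False
    then have "b > 0" using b by simp
    moreover have "0 \<le> a - (cmod c)\<^sup>2 / b"
      \<comment> \<open>The quadratic is minimal at \<open>r = 1 / b\<close>.\<close>
      using quad[of "1 / b"] False by (simp add: field_simps power2_eq_square)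
    ultimately show ?thesis
      by (simp add: field_simps)
  qed
  then show ?thesis
    by (simp add: a_def b_def c_def)
qed

lemma cinner_Cauchy_Schwarz: "cmod (cinner x y) \<le> norm x * norm (y::'a::complex_inner)"
proof -
  have "(cmod (cinner x y))\<^sup>2 \<le> (norm x * norm y)\<^sup>2"
    using nonneg_form_Cauchy_Schwarz[OF bounded_clinear_ident cinner_ge_zero, of x y]
    by (simp add: cinner_self power_mult_distrib)
  then show ?thesis
    by (rule power2_le_imp_le) simp
qed

section \<open>The numerical radius and its relation to the operator norm\<close>

lemma numerical_radius_bdd_above:
  assumes "bounded_clinear T"
  shows "bdd_above (insert 0 {cmod (cinner (T x) x) | x. norm x = 1})"
proof -
  obtain K where K: "\<And>x. norm (T x) \<le> norm x * K"
    using assms bounded_linear.bounded by (metis bounded_clinear_def)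
  have "cmod (cinner (T x) x) \<le> K" if "norm x = 1" for x
    using cinner_Cauchy_Schwarz[of "T x" x] K[of x] that by simp
  then show ?thesis
    by (auto intro!: bdd_aboveI[where M = K])
qed

lemma numerical_radius_nonneg: "bounded_clinear T \<Longrightarrow> 0 \<le> numerical_radius T"
  unfolding numerical_radius_def by (intro cSup_upper numerical_radius_bdd_above) simp_all

lemma cmod_cinner_le_numerical_radius:
  assumes T: "bounded_clinear T"
  shows "cmod (cinner (T x) x) \<le> numerical_radius T * (norm x)\<^sup>2"
proof (cases "x = 0")
  case True
  then show ?thesis
    by (simp add: bounded_clinear_zero[OF T] cinner_self)
next
  case False
  define u where "u = x /\<^sub>R norm x"
  have u: "norm u = 1" "x = complex_of_real (norm x) *\<^sub>C u"
    using False by (simp_all add: u_def flip: scaleR_scaleC)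
  have "cmod (cinner (T u) u) \<le> numerical_radius T"
    unfolding numerical_radius_def
    using u(1) by (intro cSup_upper numerical_radius_bdd_above[OF T]) auto
  moreover have "cinner (T x) x = complex_of_real ((norm x)\<^sup>2) * cinner (T u) u"
    by (subst (1 2) u(2)) (simp add: bounded_clinear_scaleC[OF T] cinner_scaleC_left
        cinner_scaleC_right power2_eq_square)
  ultimately show ?thesis
    by (simp add: norm_mult norm_power mult_right_mono mult.commute)
qed

text \<open>The test vector is \<open>T x\<close> rescaled to the length of \<open>x\<close>. Asking
  only for \<open>y\<close> of that length lets later estimates treat \<open>x\<close> and
  \<open>y\<close> symmetrically.\<close>

lemma norm_le_of_equinorm_form_bound:
  fixes T :: "'a::complex_inner \<Rightarrow> 'a"
  assumes T: "bounded_clinear T"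
    and bound: "\<And>y. norm y = norm x \<Longrightarrow> cmod (cinner (T x) y) \<le> K * (norm x)\<^sup>2"
  shows "norm (T x) \<le> K * norm x"
proof (cases "T x = 0")
  case True
  \<comment> \<open>The sign of \<open>K\<close> is read off from the bound at
    \<open>y = x\<close>.\<close>
  have "0 \<le> K * (norm x)\<^sup>2"
    using bound[of x] norm_ge_zero order_trans by blast
  then show ?thesis
    using True by (cases "x = 0") (simp_all add: zero_le_mult_iff)
next
  case False
  then have x: "norm x > 0"
    using bounded_clinear_zero[OF T] by auto
  define r where "r = norm x / norm (T x)"
  have "cmod (cinner (T x) (complex_of_real r *\<^sub>C T x)) \<le> K * (norm x)\<^sup>2"
    using False by (intro bound, unfold scaleR_scaleC[symmetric]) (simp add: r_def)
  moreover have "cinner (T x) (complex_of_real r *\<^sub>C T x) = complex_of_real (norm x * norm (T x))"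
    using False by (simp add: cinner_scaleC_right cinner_self r_def power2_eq_square)
  ultimately have "norm x * norm (T x) \<le> norm x * (K * norm x)"
    by (simp add: norm_mult power2_eq_square algebra_simps)
  then show ?thesis
    using x by simp
qed

text \<open>Polarization writes four times \<open>cinner (T x) y\<close> through the quadratic form
  at four vectors, whose squared norms add up to \<open>8 * (norm x)\<^sup>2\<close> by the
  parallelogram law; the constant is 8 / 4.\<close>

lemma norm_le_two_numerical_radius:
  fixes T :: "'a::complex_inner \<Rightarrow> 'a"
  assumes T: "bounded_clinear T"
  shows "norm (T x) \<le> 2 * numerical_radius T * norm x"
proof (rule norm_le_of_equinorm_form_bound[OF T])
  fix y :: 'a
  assume y: "norm y = norm x"
  define q where "q c = cinner (T (x + c *\<^sub>C y)) (x + c *\<^sub>C y)" for c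
  define n where "n c = (norm (x + c *\<^sub>C y))\<^sup>2" for c
  have q: "cmod (q c) \<le> numerical_radius T * n c" for c
    unfolding q_def n_def by (rule cmod_cinner_le_numerical_radius[OF T])
  have polar: "4 * cinner (T x) y = q 1 - q (- 1) + \<i> * q \<i> - \<i> * q (- \<i>)"
    unfolding q_def cinner_clinear_expand[OF T] by (simp add: algebra_simps)
  \<comment> \<open>The expansion for the identity map applies; its cross terms cancel when summed
    over the fourth roots of unity.\<close>
  have "n c = Re (cinner (x + c *\<^sub>C y) (x + c *\<^sub>C y))" for c
    by (simp add: n_def cinner_self)
  then have n: "n 1 + n (- 1) + n \<i> + n (- \<i>) = 8 * (norm x)\<^sup>2"
    unfolding cinner_clinear_expand[OF bounded_clinear_ident] by (simp add: cinner_self y)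
  have "4 * cmod (cinner (T x) y) = cmod (q 1 - q (- 1) + \<i> * q \<i> - \<i> * q (- \<i>))"
    unfolding polar[symmetric] by (simp add: norm_mult)
  also have "\<dots> \<le> cmod (q 1) + cmod (q (- 1)) + cmod (q \<i>) + cmod (q (- \<i>))"
    by (intro norm_triangle_le_diff norm_triangle_le add_mono) (simp_all add: norm_mult)
  also have "\<dots> \<le> numerical_radius T * (n 1 + n (- 1) + n \<i> + n (- \<i>))"
    using q[of 1] q[of "- 1"] q[of \<i>] q[of "- \<i>"] by (simp add: distrib_left)
  finally show "cmod (cinner (T x) y) \<le> 2 * numerical_radius T * (norm x)\<^sup>2"
    by (simp add: n)
qed

section \<open>The sharper norm bound for accretive-dissipative operators\<close>

lemma positive_operator_nonneg: "positive_operator A \<Longrightarrow> 0 \<le> cinner (A x) x"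
  by (cases "x = 0") (auto simp: positive_operator_def bounded_clinear_zero cinner_self less_imp_le)

text \<open>Pointwise algebra: the factor \<open>\<i>\<close> turns \<open>1 / (2 * \<i>)\<close>
  into \<open>1 / 2\<close>, and the two adjoint terms cancel.\<close>

lemma cartesian_decomposition: "T x = real_part T x + \<i> *\<^sub>C imag_part T x"
proof -
  have "real_part T x + \<i> *\<^sub>C imag_part T x = (1 / 2) *\<^sub>C (T x + T x)"
    by (simp add: real_part_def imag_part_def scaleC_scaleC flip: scaleC_add_right)
  also have "\<dots> = (1 / 2 + 1 / 2) *\<^sub>C T x"
    by (simp only: scaleC_add_right scaleC_add_left)
  finally show ?thesis by (simp add: scaleC_one)
qed

text \<open>Cauchy-Schwarz in the plane against the vector (1, 1), of length
  \<open>sqrt 2\<close>.\<close>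

lemma add_le_sqrt2_cmod: "Re z + Im z \<le> sqrt 2 * cmod z"
proof -
  have "Re z + Im z \<le> sqrt (2 * ((Re z)\<^sup>2 + (Im z)\<^sup>2))"
    by (rule real_le_rsqrt) (use sum_squares_bound[of "Re z" "Im z"] in \<open>simp add: power2_sum\<close>)
  then show ?thesis
    by (simp only: cmod_def real_sqrt_mult)
qed

text \<open>Cauchy-Schwarz in the plane for the vectors (\<open>sqrt a\<close>,
  \<open>sqrt c\<close>) and (\<open>sqrt b\<close>, \<open>sqrt d\<close>).\<close>

lemma sqrt_mult_add_le:
  fixes a b c d :: real
  assumes "0 \<le> a" "0 \<le> b" "0 \<le> c" "0 \<le> d"
  shows "sqrt (a * b) + sqrt (c * d) \<le> sqrt ((a + c) * (b + d))"
proof (rule real_le_rsqrt)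
  \<comment> \<open>The factors are regrouped so that the right side is exactly the mixed part of
    \<open>(a + c) * (b + d)\<close>.\<close>
  have "2 * (sqrt (a * d) * sqrt (c * b)) \<le> a * d + c * b"
    using sum_squares_bound[of "sqrt (a * d)" "sqrt (c * b)"] assms by simp
  moreover have "sqrt (a * d) * sqrt (c * b) = sqrt (a * b) * sqrt (c * d)"
    by (simp add: real_sqrt_mult)
  ultimately show "(sqrt (a * b) + sqrt (c * d))\<^sup>2 \<le> (a + c) * (b + d)"
    using assms by (simp add: power2_sum algebra_simps)
qed

lemma accretive_dissipative_norm_le:
  fixes T :: "'a::complex_hilbert_space \<Rightarrow> 'a"
  assumes "accretive_dissipative T"
  shows "norm (T x) \<le> sqrt 2 * numerical_radius T * norm x"
proof -
  define A where "A = real_part T"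
  define B where "B = imag_part T"
  have T: "bounded_clinear T" and A: "bounded_clinear A" and B: "bounded_clinear B"
    and pA: "\<And>z. 0 \<le> cinner (A z) z" and pB: "\<And>z. 0 \<le> cinner (B z) z"
    using assms positive_operator_nonneg
    by (auto simp: accretive_dissipative_def positive_operator_def A_def B_def)
  have decomp: "cinner (T u) v = cinner (A u) v + \<i> * cinner (B u) v" for u v
    by (subst cartesian_decomposition) (simp add: A_def B_def cinner_add_left cinner_scaleC_left)
  define a where "a z = Re (cinner (A z) z)" for z
  define b where "b z = Re (cinner (B z) z)" for z
  have nonneg: "0 \<le> a z" "0 \<le> b z" for z
    using pA[of z] pB[of z] by (simp_all add: a_def b_def less_eq_complex_def)
  have sum_le: "a z + b z \<le> sqrt 2 * numerical_radius T * (norm z)\<^sup>2" for z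
  proof -
    have "a z + b z = Re (cinner (T z) z) + Im (cinner (T z) z)"
      using pA[of z] pB[of z] by (simp add: decomp a_def b_def less_eq_complex_def)
    also have "\<dots> \<le> sqrt 2 * cmod (cinner (T z) z)"
      by (rule add_le_sqrt2_cmod)
    also have "\<dots> \<le> sqrt 2 * (numerical_radius T * (norm z)\<^sup>2)"
      by (simp add: cmod_cinner_le_numerical_radius[OF T])
    finally show ?thesis by (simp add: mult.assoc)
  qed
  show ?thesis
  proof (rule norm_le_of_equinorm_form_bound[OF T])
    fix y :: 'a
    assume y: "norm y = norm x"
    have "cmod (cinner (T x) y) \<le> cmod (cinner (A x) y) + cmod (cinner (B x) y)"
      unfolding decomp by (rule norm_triangle_le) (simp add: norm_mult)
    also have "\<dots> \<le> sqrt (a x * a y) + sqrt (b x * b y)"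
      unfolding a_def b_def
      by (intro add_mono real_le_rsqrt nonneg_form_Cauchy_Schwarz A B pA pB)
    also have "\<dots> \<le> sqrt ((a x + b x) * (a y + b y))"
      by (intro sqrt_mult_add_le nonneg)
    \<comment> \<open>Because \<open>x\<close> and \<open>y\<close> have equal norms,
      \<open>sum_le\<close> bounds both factors by the same number, and the root undoes the
      square.\<close>
    also have "\<dots> \<le> sqrt ((sqrt 2 * numerical_radius T * (norm x)\<^sup>2)\<^sup>2)"
      unfolding power2_eq_square[of "_ * _ * _"]
      using sum_le[of x] sum_le[of y] nonneg numerical_radius_nonneg[OF T]
      by (intro real_sqrt_le_mono mult_mono) (simp_all add: y)
    finally show "cmod (cinner (T x) y) \<le> sqrt 2 * numerical_radius T * (norm x)\<^sup>2"
      using numerical_radius_nonneg[OF T] by simp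
  qed
qed

section \<open>Products of operators\<close>

lemma numerical_radius_comp_le:
  assumes S: "\<And>x. norm (S x) \<le> K * norm x" and T: "\<And>x. norm (T x) \<le> L * norm x"
    and "0 \<le> K" "0 \<le> L"
  shows "numerical_radius (S \<circ> T) \<le> K * L"
  unfolding numerical_radius_def
proof (rule cSup_least)
  have "cmod (cinner ((S \<circ> T) x) x) \<le> K * L" if "norm x = 1" for x
  proof -
    have "cmod (cinner ((S \<circ> T) x) x) \<le> norm (S (T x))"
      using cinner_Cauchy_Schwarz[of "S (T x)" x] that by simp
    also have "\<dots> \<le> K * norm (T x)"
      by (rule S)
    also have "\<dots> \<le> K * L"
      using T[of x] that \<open>0 \<le> K\<close> by (simp add: mult_left_mono)
    finally show ?thesis .
  qed
  \<comment> \<open>The inserted \<open>0\<close> is bounded through the signs of \<open>K\<close>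
    and \<open>L\<close>.\<close>
  then show "r \<le> K * L" if "r \<in> insert 0 {cmod (cinner ((S \<circ> T) x) x) | x. norm x = 1}" for r
    using that assms(3,4) by auto
qed simp

theorem corollary2p3:
  fixes S T :: "'a::complex_hilbert_space \<Rightarrow> 'a"
  assumes "bounded_clinear S" and "bounded_clinear T"
  shows "(accretive_dissipative S \<and> accretive_dissipative T \<longrightarrow>
      numerical_radius (S \<circ> T) \<le> 2 * numerical_radius S * numerical_radius T) \<and>
    (accretive_dissipative S \<or> accretive_dissipative T \<longrightarrow>
      numerical_radius (S \<circ> T) \<le> 2 * sqrt 2 * numerical_radius S * numerical_radius T)"
proof (intro conjI impI)
  note nonneg = assms[THEN numerical_radius_nonneg]
  note general = assms[THEN norm_le_two_numerical_radius]
  \<comment> \<open>Each factor contributes \<open>sqrt 2\<close> where it is known to be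
    accretive-dissipative and \<open>2\<close> otherwise; the constants of the theorem are the
    products.\<close>
  note comp = numerical_radius_comp_le[OF _ _ mult_nonneg_nonneg mult_nonneg_nonneg]
  {
    assume "accretive_dissipative S \<and> accretive_dissipative T"
    then have "numerical_radius (S \<circ> T) \<le>
        (sqrt 2 * numerical_radius S) * (sqrt 2 * numerical_radius T)"
      by (intro comp accretive_dissipative_norm_le nonneg) simp_all
    also have "\<dots> = (sqrt 2 * sqrt 2) * numerical_radius S * numerical_radius T"
      by (simp only: mult_ac)
    finally show "numerical_radius (S \<circ> T) \<le> 2 * numerical_radius S * numerical_radius T"
      by simp
  next
    assume "accretive_dissipative S \<or> accretive_dissipative T"
    then show "numerical_radius (S \<circ> T) \<le> 2 * sqrt 2 * numerical_radius S * numerical_radius T"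
    proof
      assume "accretive_dissipative S"
      then have "numerical_radius (S \<circ> T) \<le>
          (sqrt 2 * numerical_radius S) * (2 * numerical_radius T)"
        by (intro comp accretive_dissipative_norm_le general nonneg) simp_all
      then show ?thesis
        by (simp add: mult_ac)
    next
      assume "accretive_dissipative T"
      then have "numerical_radius (S \<circ> T) \<le>
          (2 * numerical_radius S) * (sqrt 2 * numerical_radius T)"
        by (intro comp accretive_dissipative_norm_le general nonneg) simp_all
      then show ?thesis
        by (simp add: mult_ac)
    qed
  }
qed

end
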